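(* Let $g,m,n$ be positive integers. If there exists a Kirkman frame of type $(2g)^n$ which contains as a subdesign a $3$-GDD of type $g^n$, a resolvable TD$(3,m)$, and an MK$(2gm+3)$, then there exists an MK$(2gmn+3)$.
   Context: An STS$(v)$ is a set of $v$ points with a set of 3-subsets (blocks) such that each pair of distinct points lies in exactly one block; a KTS$(v)$ is an STS$(v)$ whose blocks partition into parallel classes (partitions of the point set); a subdesign is a subset of points with a subset of blocks forming an STS on that subset. MK$(v)$ denotes a KTS$(v)$ containing an STS$((v-1)/2)$ as a subdesign. A 3-GDD of type $g^u$ on a point set $V$ is a partition of $V$ into $u$ groups of size $g$ with a set of 3-subset blocks, each meeting every group in at most one point, such that any two points in different groups lie in exactly one block. A TD$(3,m)$ is a 3-GDD of type $m^3$; it is resolvable if its blocks partition into parallel classes. A Kirkman frame is a 3-GDD whose blocks can be partitioned into partial parallel classes, each a partition of $V\setminus V_i$ for some group $V_i$. A Kirkman frame of type $h^u$ (groups $V_i$, blocks $\mathcal{B}$) contains a 3-GDD of type $g^u$ (groups $W_i$, blocks $\mathcal{A}$) as a subdesign if $W_i\subseteq V_i$ for all $i$ and $\mathcal{A}\subseteq\mathcal{B}$. *)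

theory Defs
  imports Main "HOL-Library.Disjoint_Sets"
begin

definition sts :: "nat \<Rightarrow> 'a set \<Rightarrow> 'a set set \<Rightarrow> bool" where
  "sts v V B \<longleftrightarrow>
     finite V \<and> card V = v \<and>
     (\<forall>b\<in>B. b \<subseteq> V \<and> card b = 3) \<and>
     (\<forall>x\<in>V. \<forall>y\<in>V. x \<noteq> y \<longrightarrow> (\<exists>!b. b \<in> B \<and> x \<in> b \<and> y \<in> b))"

definition resolvable :: "'a set \<Rightarrow> 'a set set \<Rightarrow> bool" where
  "resolvable V B \<longleftrightarrow> (\<exists>R. partition_on B R \<and> (\<forall>P\<in>R. partition_on V P))"

definition kts :: "nat \<Rightarrow> 'a set \<Rightarrow> 'a set set \<Rightarrow> bool" where
  "kts v V B \<longleftrightarrow> sts v V B \<and> resolvable V B"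

text \<open>The existence predicates below quantify over point sets in \<^typ>\<open>nat\<close>; every design considered
  here is finite, so up to isomorphism this is no restriction.\<close>

text \<open>The equation \<open>v = 2 * w + 1\<close> expresses \<open>w = (v - 1) / 2\<close> without truncating division.\<close>

definition MK :: "nat \<Rightarrow> bool" where
  "MK v \<longleftrightarrow>
     (\<exists>(V :: nat set) B W A w. kts v V B \<and> v = 2 * w + 1 \<and> W \<subseteq> V \<and> A \<subseteq> B \<and> sts w W A)"

text \<open>\<open>gdd3 g u V G B\<close>: a 3-GDD of type \<open>g\<^sup>u\<close> with points \<open>V\<close>, groups \<open>G\<close> and blocks \<open>B\<close>.\<close>

definition gdd3 :: "nat \<Rightarrow> nat \<Rightarrow> 'a set \<Rightarrow> 'a set set \<Rightarrow> 'a set set \<Rightarrow> bool" where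
  "gdd3 g u V G B \<longleftrightarrow>
     finite V \<and> partition_on V G \<and> card G = u \<and> (\<forall>X\<in>G. card X = g) \<and>
     (\<forall>b\<in>B. b \<subseteq> V \<and> card b = 3 \<and> (\<forall>X\<in>G. card (b \<inter> X) \<le> 1)) \<and>
     (\<forall>X\<in>G. \<forall>Y\<in>G. X \<noteq> Y \<longrightarrow>
        (\<forall>x\<in>X. \<forall>y\<in>Y. \<exists>!b. b \<in> B \<and> x \<in> b \<and> y \<in> b))"

definition exists_resolvable_TD3 :: "nat \<Rightarrow> bool" where
  "exists_resolvable_TD3 m \<longleftrightarrow> (\<exists>(V :: nat set) G B. gdd3 m 3 V G B \<and> resolvable V B)"

definition kirkman_frame :: "nat \<Rightarrow> nat \<Rightarrow> 'a set \<Rightarrow> 'a set set \<Rightarrow> 'a set set \<Rightarrow> bool" where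
  "kirkman_frame h u V G B \<longleftrightarrow>
     gdd3 h u V G B \<and>
     (\<exists>R. partition_on B R \<and> (\<forall>P\<in>R. \<exists>X\<in>G. partition_on (V - X) P))"

text \<open>Groups form an unindexed family, so the common indexing in \<open>W\<^sub>i \<subseteq> V\<^sub>i\<close> is
  given by a bijection \<open>f\<close> from the groups \<open>V\<^sub>i\<close> to the groups \<open>W\<^sub>i\<close>.\<close>

definition gdd_subdesign ::
    "'a set set \<Rightarrow> 'a set set \<Rightarrow> 'a set set \<Rightarrow> 'a set set \<Rightarrow> bool" where
  "gdd_subdesign H A G B \<longleftrightarrow>
     (\<exists>f. bij_betw f G H \<and> (\<forall>X\<in>G. f X \<subseteq> X)) \<and> A \<subseteq> B"

definition exists_frame_with_subgdd :: "nat \<Rightarrow> nat \<Rightarrow> nat \<Rightarrow> bool" where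
  "exists_frame_with_subgdd h g u \<longleftrightarrow>
     (\<exists>(V :: nat set) G B W H A.
        kirkman_frame h u V G B \<and> gdd3 g u W H A \<and> gdd_subdesign H A G B)"

end

(* Give weight m to the frame: over a block b, a copy of the resolvable TD(3,m) is placed on
   b x M, so that a partial parallel class of the frame and a parallel class of the TD combine to a
   partial parallel class. This yields a Kirkman frame of type (2gm)^n with a sub-GDD of type (gm)^n.
   Then add three points S and place a copy of the MK(2gm+3) on X + S for every group X. The copy
   is chosen such that S is one of its blocks, lying in the class Q_X, and its sub-STS(gm+1) sits
   on the subgroup of X plus one fixed point of S; this is possible because any block joining a point
   of the subsystem to a point outside meets the subsystem only once. Counting shows that both the
   number of frame classes missing X and the number of classes of the copy other than Q_X are gm,
   so they can be matched up; the classes Q_X themselves merge into one last parallel class.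
   For n = 1 there is nothing to prove, and the counting would fail there. *)

theory Submission
  imports Defs "HOL-Library.Countable"
begin

section \<open>Counting blocks and parallel classes through a point\<close>

text \<open>Removing \<open>x\<close> from the blocks, all of which contain it, leaves disjoint
  pairs that cover \<open>U\<close>.\<close>

lemma card_through_point:
  assumes "finite B" "finite U" "x \<notin> U"
    and B: "\<And>b. b \<in> B \<Longrightarrow> x \<in> b" "\<And>b. b \<in> B \<Longrightarrow> card b = 3"
      "\<And>b. b \<in> B \<Longrightarrow> b \<subseteq> insert x U"
    and ex1: "\<And>y. y \<in> U \<Longrightarrow> \<exists>!b. b \<in> B \<and> y \<in> b"
  shows "card U = 2 * card B"
proof -
  have U: "U = (\<Union>b\<in>B. b - {x})"
  proof (intro equalityI subsetI)
    fix y assume "y \<in> U"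
    then show "y \<in> (\<Union>b\<in>B. b - {x})" using ex1 \<open>x \<notin> U\<close> by (metis DiffI UN_I singletonD)
  qed (use B(3) in blast)
  have "card (\<Union>b\<in>B. b - {x}) = (\<Sum>b\<in>B. card (b - {x}))"
  proof (rule card_UN_disjoint[OF assms(1)])
    show "\<forall>b\<in>B. finite (b - {x})"
      using B(3) assms(2) by (meson finite_Diff finite_insert finite_subset)
    show "\<forall>b\<in>B. \<forall>c\<in>B. b \<noteq> c \<longrightarrow> (b - {x}) \<inter> (c - {x}) = {}"
    proof (intro ballI impI, rule ccontr)
      fix b c assume bc: "b \<in> B" "c \<in> B" "b \<noteq> c" "(b - {x}) \<inter> (c - {x}) \<noteq> {}"
      then obtain y where y: "y \<in> b" "y \<in> c" "y \<noteq> x" by blast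
      then have "y \<in> U" using B(3)[OF bc(1)] by blast
      from ex1[OF this] show False using bc(1-3) y(1,2) by metis
    qed
  qed
  also have "\<dots> = (\<Sum>b\<in>B. 2)"
    by (rule sum.cong) (use B(1,2) in simp_all)
  finally show ?thesis using U by simp
qed

text \<open>Mapping a class to its only block through \<open>x\<close> is a bijection: classes are
  disjoint, and by the last assumption every block through \<open>x\<close> lies in a class of
  \<open>Q\<close>. For a KTS, \<open>Q\<close> will be the whole resolution; for a frame, the
  classes that do not miss the group of \<open>x\<close>.\<close>

lemma card_classes_through_point:
  assumes "partition_on B R" "Q \<subseteq> R"
    and "\<And>P. P \<in> Q \<Longrightarrow> \<exists>!b. b \<in> P \<and> x \<in> b"
    and "\<And>P b. P \<in> R \<Longrightarrow> b \<in> P \<Longrightarrow> x \<in> b \<Longrightarrow> P \<in> Q"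
  shows "card Q = card {b\<in>B. x \<in> b}"
proof -
  have "bij_betw (\<lambda>P. THE b. b \<in> P \<and> x \<in> b) Q {b\<in>B. x \<in> b}"
    unfolding bij_betw_def
  proof
    have the: "(THE b. b \<in> P \<and> x \<in> b) \<in> P \<and> x \<in> (THE b. b \<in> P \<and> x \<in> b)" if "P \<in> Q" for P
      using theI'[OF assms(3)[OF that]] .
    show "inj_on (\<lambda>P. THE b. b \<in> P \<and> x \<in> b) Q"
    proof (rule inj_onI)
      fix P P' assume P: "P \<in> Q" "P' \<in> Q"
        and eq: "(THE b. b \<in> P \<and> x \<in> b) = (THE b. b \<in> P' \<and> x \<in> b)"
      then have "P \<inter> P' \<noteq> {}"
        using the[OF P(1)] the[OF P(2)] by auto
      then show "P = P'"
        using assms(1,2) P partition_onD2[OF assms(1)] by (auto dest: disjointD)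
    qed
    show "(\<lambda>P. THE b. b \<in> P \<and> x \<in> b) ` Q = {b\<in>B. x \<in> b}"
    proof (intro equalityI subsetI)
      fix b assume "b \<in> (\<lambda>P. THE b. b \<in> P \<and> x \<in> b) ` Q"
      then show "b \<in> {b\<in>B. x \<in> b}"
        using the assms(2) partition_onD1[OF assms(1)] by blast
    next
      fix b assume b: "b \<in> {b\<in>B. x \<in> b}"
      then obtain P where P: "P \<in> R" "b \<in> P"
        using partition_onD1[OF assms(1)] by blast
      then have "P \<in> Q" using assms(4) b by blast
      moreover have "(THE b. b \<in> P \<and> x \<in> b) = b"
        using the1_equality[OF assms(3)[OF \<open>P \<in> Q\<close>]] P b by blast
      ultimately show "b \<in> (\<lambda>P. THE b. b \<in> P \<and> x \<in> b) ` Q" by force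
    qed
  qed
  then show ?thesis by (rule bij_betw_same_card)
qed

section \<open>Partitions, designs and their transport along injections\<close>

lemma partition_on_same:
  assumes "partition_on A P" "b \<in> P" "c \<in> P" "x \<in> b" "x \<in> c"
  shows "b = c"
  using assms(2-) disjointD[OF partition_onD2[OF assms(1)], of b c] by blast

lemma partition_on_ex1:
  assumes "partition_on A P" "x \<in> A"
  shows "\<exists>!b. b \<in> P \<and> x \<in> b"
proof -
  obtain b where "b \<in> P" "x \<in> b" using partition_onD1[OF assms(1)] assms(2) by blast
  then show ?thesis using partition_on_same[OF assms(1)] by (intro ex1I[of _ b]) blast+
qed

lemma finite_blocks: "finite V \<Longrightarrow> (\<And>b. b \<in> B \<Longrightarrow> b \<subseteq> V) \<Longrightarrow> finite B"
  by (rule finite_subset[of _ "Pow V"]) auto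

lemma sts_blocks: "sts v V B \<Longrightarrow> \<forall>b\<in>B. b \<subseteq> V"
  by (simp add: sts_def)

lemma gdd3D:
  assumes "gdd3 g u V G B"
  shows "finite V" "partition_on V G" "card G = u" "X \<in> G \<Longrightarrow> card X = g"
    and "b \<in> B \<Longrightarrow> b \<subseteq> V" "b \<in> B \<Longrightarrow> card b = 3"
    and "b \<in> B \<Longrightarrow> X \<in> G \<Longrightarrow> card (b \<inter> X) \<le> 1"
    and "X \<in> G \<Longrightarrow> Y \<in> G \<Longrightarrow> X \<noteq> Y \<Longrightarrow> x \<in> X \<Longrightarrow> y \<in> Y
      \<Longrightarrow> \<exists>!b. b \<in> B \<and> x \<in> b \<and> y \<in> b"
  using assms unfolding gdd3_def by simp_all

lemma gdd3_group_subset: "gdd3 g u V G B \<Longrightarrow> X \<in> G \<Longrightarrow> X \<subseteq> V"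
  using partition_onD1[OF gdd3D(2)] by blast

lemma gdd3_block_group:
  assumes gdd: "gdd3 g u V G B" and "b \<in> B" "X \<in> G" "x \<in> b" "y \<in> b" "x \<in> X" "y \<in> X"
  shows "x = y"
proof -
  have "finite (b \<inter> X)" using gdd3D(1,5)[OF gdd] assms(2) by (meson finite_Int finite_subset)
  moreover have "card (b \<inter> X) \<le> Suc 0" using gdd3D(7)[OF gdd assms(2,3)] by simp
  ultimately show ?thesis using assms(4-7) card_le_Suc0_iff_eq by blast
qed

lemma sts_pair:
  "sts v V B \<Longrightarrow> x \<in> V \<Longrightarrow> y \<in> V \<Longrightarrow> x \<noteq> y \<Longrightarrow> \<exists>!b. b \<in> B \<and> x \<in> b \<and> y \<in> b"
  by (simp add: sts_def)

lemma sts_image: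
  assumes "sts v V B" "inj_on f V"
  shows "sts v (f ` V) ((`) f ` B)"
proof -
  have V: "finite V" "card V = v" and B: "\<And>b. b \<in> B \<Longrightarrow> b \<subseteq> V \<and> card b = 3"
    using assms(1) by (simp_all add: sts_def)
  have mem: "f x \<in> f ` b \<longleftrightarrow> x \<in> b" if "x \<in> V" "b \<in> B" for x b
    using that B assms(2) by (meson inj_on_image_mem_iff)
  show ?thesis unfolding sts_def
  proof (intro conjI ballI impI)
    fix b assume "b \<in> (`) f ` B"
    then show "b \<subseteq> f ` V" "card b = 3"
      using B assms(2) by (auto simp: card_image inj_on_subset)
  next
    fix p q assume pq: "p \<in> f ` V" "q \<in> f ` V" "p \<noteq> q"
    then obtain x y where xy: "p = f x" "q = f y" "x \<in> V" "y \<in> V" "x \<noteq> y" by blast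
    then obtain b where b: "b \<in> B" "x \<in> b" "y \<in> b"
      "\<And>c. c \<in> B \<Longrightarrow> x \<in> c \<Longrightarrow> y \<in> c \<Longrightarrow> c = b"
      using sts_pair[OF assms(1) xy(3-5)] by blast
    show "\<exists>!b. b \<in> (`) f ` B \<and> p \<in> b \<and> q \<in> b"
    proof (rule ex1I[of _ "f ` b"])
      show "f ` b \<in> (`) f ` B \<and> p \<in> f ` b \<and> q \<in> f ` b" using b xy by blast
      fix d assume d: "d \<in> (`) f ` B \<and> p \<in> d \<and> q \<in> d"
      then obtain c where c: "c \<in> B" "d = f ` c" by blast
      then have "x \<in> c" "y \<in> c" using d xy(1,2) mem[OF xy(3)] mem[OF xy(4)] by simp_all
      then show "d = f ` b" using b(4)[OF c(1)] c(2) by simp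
    qed
  qed (use V assms(2) in \<open>auto simp: card_image\<close>)
qed

lemma partition_on_image:
  assumes "partition_on A P" "inj_on f A"
  shows "partition_on (f ` A) ((`) f ` P)"
proof -
  \<comment> \<open>No member is empty, so removing the empty set, as in the conclusion of
    \<open>partition_on_inj_image\<close>, changes nothing.\<close>
  have "(`) f ` P - {{}} = (`) f ` P"
    using partition_onD3[OF assms(1)] by auto
  then show ?thesis using partition_on_inj_image[OF assms] by simp
qed

lemma resolvable_image:
  assumes "resolvable V B" "\<forall>b\<in>B. b \<subseteq> V" "inj_on f V"
  shows "resolvable (f ` V) ((`) f ` B)"
proof -
  obtain R where R: "partition_on B R" "\<forall>P\<in>R. partition_on V P"
    using assms(1) by (auto simp: resolvable_def)
  \<comment> \<open>The resolution is a partition of the set of blocks, so transporting it requires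
    the induced map on blocks to be injective as well.\<close>
  have "inj_on ((`) f) B"
    using inj_on_image_Pow[OF assms(3)] by (rule inj_on_subset) (use assms(2) in auto)
  from partition_on_image[OF R(1) this] partition_on_image[OF _ assms(3)] R(2)
  show ?thesis unfolding resolvable_def
    by (intro exI[of _ "(`) ((`) f) ` R"]) auto
qed

lemma kts_image:
  "kts v V B \<Longrightarrow> inj_on f V \<Longrightarrow> kts v (f ` V) ((`) f ` B)"
  unfolding kts_def using sts_image resolvable_image sts_blocks by metis

section \<open>Numbers of parallel classes\<close>

text \<open>Every class has exactly one block on a fixed point \<open>x\<close>, and the blocks
  through \<open>x\<close> pair off the other \<open>2 * k\<close> points.\<close>

lemma kts_card_classes:
  assumes "sts (2 * k + 1) V B" "partition_on B R" "\<forall>P\<in>R. partition_on V P"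
  shows "card R = k"
proof -
  have V: "finite V" "card V = 2 * k + 1" using assms(1) by (simp_all add: sts_def)
  have "V \<noteq> {}" using V(2) by auto
  then obtain x where x: "x \<in> V" by blast
  have "card R = card {b\<in>B. x \<in> b}"
  proof (rule card_classes_through_point[OF assms(2)])
    show "\<exists>!b. b \<in> P \<and> x \<in> b" if "P \<in> R" for P
      using partition_on_ex1[OF _ x] assms(3) that by simp
  qed simp_all
  moreover have "card (V - {x}) = 2 * card {b\<in>B. x \<in> b}"
  proof (rule card_through_point)
    show "finite {b\<in>B. x \<in> b}"
      using finite_blocks[OF V(1), of B] sts_blocks[OF assms(1)] by simp
    show "\<exists>!b. b \<in> {b\<in>B. x \<in> b} \<and> y \<in> b" if "y \<in> V - {x}" for y
    proof -
      have "\<exists>!b. b \<in> B \<and> x \<in> b \<and> y \<in> b"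
        using sts_pair[OF assms(1) x, of y] that by blast
      then show "\<exists>!b. b \<in> {b\<in>B. x \<in> b} \<and> y \<in> b" by simp
    qed
    show "card b = 3" if "b \<in> {b\<in>B. x \<in> b}" for b
      using that assms(1) by (simp add: sts_def)
    show "b \<subseteq> insert x (V - {x})" if "b \<in> {b\<in>B. x \<in> b}" for b
      using that sts_blocks[OF assms(1)] by blast
  qed (use V in simp_all)
  ultimately show ?thesis using V x by simp
qed

text \<open>Hence a partial parallel class of a frame is never counted for two groups.\<close>

lemma partition_on_Diff_unique:
  assumes "partition_on (V - X) P" "partition_on (V - Y) P" "X \<subseteq> V" "Y \<subseteq> V"
  shows "X = Y"
proof -
  have "V - X = V - Y" using partition_onD1[OF assms(1)] partition_onD1[OF assms(2)] by simp
  then show ?thesis using assms(3,4) by blast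
qed

text \<open>Counting blocks on a point of \<open>X\<close> gives the number of classes that do not
  miss \<open>X\<close>, and this number is the same for all groups. So \<open>r\<close> is
  constant, and since each class misses exactly one group, \<open>card R = n * r X\<close>.
  Comparing both counts and cancelling the positive factor \<open>n - 1\<close> gives the
  value.\<close>

lemma kirkman_frame_card_classes:
  assumes gdd: "gdd3 h n V G B" and "h > 0" "n \<ge> 2"
    and R: "partition_on B R" "\<forall>P\<in>R. \<exists>X\<in>G. partition_on (V - X) P"
    and "X \<in> G"
  shows "2 * card {P\<in>R. partition_on (V - X) P} = h"
proof -
  define r where "r X = card {P\<in>R. partition_on (V - X) P}" for X
  note V = gdd3D(1-3)[OF gdd] and cardX = gdd3D(4)[OF gdd] and pair = gdd3D(8)[OF gdd]
    and sub = gdd3_group_subset[OF gdd]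
  have finB: "finite B" by (rule finite_blocks[OF V(1) gdd3D(5)[OF gdd]])
  have finR: "finite R" using finB finite_elements R(1) by blast
  have finG: "finite G" using V \<open>n \<ge> 2\<close> by (metis card.infinite not_numeral_le_zero)
  have cardV: "card V = n * h"
  proof -
    have "card V = sum card G"
      using V partition_onD1[OF V(2)] partition_onD2[OF V(2)] finG sub
      by (metis card_Union_disjoint finite_subset)
    then show ?thesis using cardX V by simp
  qed
  \<comment> \<open>The second conjunct keeps the truncated subtraction exact, so that equal
    differences later force equal values of \<open>r\<close>.\<close>
  have count: "2 * (card R - r X) = (n - 1) * h \<and> r X \<le> card R" if X: "X \<in> G" for X
  proof -
    have "X \<noteq> {}" using cardX[OF X] \<open>h > 0\<close> by auto
    then obtain x where x: "x \<in> X" by blast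
    let ?Bx = "{b\<in>B. x \<in> b}"
    have "card (V - X) = 2 * card ?Bx"
    proof (rule card_through_point)
      show "b \<subseteq> insert x (V - X)" if b: "b \<in> ?Bx" for b
      proof
        fix y assume y: "y \<in> b"
        have "y = x" if "y \<in> X"
          using gdd3_block_group[OF gdd _ X] b x y that by blast
        then show "y \<in> insert x (V - X)" using y b gdd3D(5)[OF gdd] by blast
      qed
      show "\<exists>!b. b \<in> ?Bx \<and> y \<in> b" if y: "y \<in> V - X" for y
      proof -
        from y obtain Y where "Y \<in> G" "y \<in> Y" using partition_onD1[OF V(2)] by auto
        then show "\<exists>!b. b \<in> ?Bx \<and> y \<in> b"
          using pair[of X Y x y] X x y by (metis (lifting) DiffD2 mem_Collect_eq)
      qed
    qed (use V finB x gdd3D(6)[OF gdd] in simp_all)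
    \<comment> \<open>A class that does not miss \<open>X\<close> misses another group, which does
      not contain \<open>x\<close>; so it covers \<open>x\<close>.\<close>
    moreover have "card (R - {P\<in>R. partition_on (V - X) P}) = card ?Bx"
    proof (rule card_classes_through_point[OF R(1)])
      fix P assume P: "P \<in> R - {P\<in>R. partition_on (V - X) P}"
      then obtain Y where Y: "Y \<in> G" "partition_on (V - Y) P" using R(2) by auto
      then have "x \<in> V - Y"
        using P x X sub partition_on_same[OF V(2)] by blast
      then show "\<exists>!b. b \<in> P \<and> x \<in> b" by (rule partition_on_ex1[OF Y(2)])
    next
      fix P b assume "P \<in> R" "b \<in> P" "x \<in> b"
      then show "P \<in> R - {P\<in>R. partition_on (V - X) P}"
        using x partition_onD1 by blast
    qed auto
    moreover have "card (R - {P\<in>R. partition_on (V - X) P}) = card R - r X"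
      unfolding r_def by (rule card_Diff_subset) (use finR in auto)
    moreover have "r X \<le> card R" unfolding r_def using finR by (auto intro: card_mono)
    moreover have "card (V - X) = (n - 1) * h"
      using cardV cardX[OF X] sub[OF X] V(1)
      by (simp add: card_Diff_subset finite_subset algebra_simps)
    ultimately show ?thesis by simp
  qed
  have const: "r Y = r X" if "Y \<in> G" for Y
    using count[OF that] count[OF \<open>X \<in> G\<close>] by linarith
  have "card (\<Union>Y\<in>G. {P\<in>R. partition_on (V - Y) P}) = (\<Sum>Y\<in>G. r Y)"
    unfolding r_def
  proof (rule card_UN_disjoint[OF finG])
    show "\<forall>X\<in>G. \<forall>Y\<in>G. X \<noteq> Y \<longrightarrow>
      {P\<in>R. partition_on (V - X) P} \<inter> {P\<in>R. partition_on (V - Y) P} = {}"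
    proof (intro ballI impI, rule ccontr)
      fix X Y assume XY: "X \<in> G" "Y \<in> G" "X \<noteq> Y"
        "{P\<in>R. partition_on (V - X) P} \<inter> {P\<in>R. partition_on (V - Y) P} \<noteq> {}"
      then show False using partition_on_Diff_unique[OF _ _ sub sub] by blast
    qed
  qed (use finR in auto)
  moreover have "(\<Union>Y\<in>G. {P\<in>R. partition_on (V - Y) P}) = R" using R(2) by auto
  ultimately have "card R = n * r X" using const V by simp
  then have "card R - r X = (n - 1) * r X" by (simp add: diff_mult_distrib)
  then have "(n - 1) * (2 * r X) = (n - 1) * h"
    using count[OF \<open>X \<in> G\<close>] by (simp add: mult.left_commute)
  then show ?thesis using \<open>n \<ge> 2\<close> unfolding r_def by simp
qed

section \<open>Gluing partitions and filling in groups\<close>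

lemma partition_on_Un:
  assumes "partition_on A P" "partition_on A' Q" "A \<inter> A' = {}"
  shows "partition_on (A \<union> A') (P \<union> Q)"
  using assms unfolding partition_on_def by (auto intro!: disjoint_union)

lemma partition_on_remove:
  assumes "partition_on A P" "b \<in> P"
  shows "partition_on (A - b) (P - {b})"
proof (rule partition_onI)
  show "\<Union>(P - {b}) = A - b"
    using assms partition_onD1[OF assms(1)] partition_on_same[OF assms(1)] by blast
  show "disjnt p q" if "p \<in> P - {b}" "q \<in> P - {b}" "p \<noteq> q" for p q
    using that partition_on_same[OF assms(1)] unfolding disjnt_def by blast
qed (use partition_onD3[OF assms(1)] in auto)

lemma partition_on_UN:
  assumes "partition_on V G" "\<And>X. X \<in> G \<Longrightarrow> partition_on X (N X)"
  shows "partition_on V (\<Union>X\<in>G. N X)"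
proof (rule partition_onI)
  show "\<Union>(\<Union>X\<in>G. N X) = V"
    using partition_onD1[OF assms(1)] partition_onD1[OF assms(2)] by blast
  fix p q assume "p \<in> (\<Union>X\<in>G. N X)" "q \<in> (\<Union>X\<in>G. N X)" "p \<noteq> q"
  then obtain X Y where XY: "X \<in> G" "Y \<in> G" "p \<in> N X" "q \<in> N Y" by blast
  have sub: "p \<subseteq> X" "q \<subseteq> Y"
    using XY partition_onD1[OF assms(2)] by blast+
  show "disjnt p q"
  proof (rule ccontr)
    assume "\<not> disjnt p q"
    then obtain x where x: "x \<in> p" "x \<in> q" unfolding disjnt_def by blast
    then have "X = Y" using partition_on_same[OF assms(1)] XY sub by blast
    then show False using x XY \<open>p \<noteq> q\<close> partition_on_same[OF assms(2)] by blast
  qed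
qed (use partition_onD3[OF assms(2)] in auto)

text \<open>Two points of one group, or a point of a group and one of \<open>S\<close>, are joined
  only in the copy for that group; points of different groups only in \<open>B\<close>. Two points
  of \<open>S\<close> lie in every copy, and there the inclusion of \<open>D\<close> in each
  \<open>C X\<close> prevents competing blocks. The size \<open>s\<close> is left open because both
  \<open>s = 3\<close> with one block and \<open>s = 1\<close> with none occur later.\<close>

lemma sts_fill:
  assumes gdd: "gdd3 g n V G B" and S: "S \<inter> V = {}" "sts s S D"
    and C: "\<And>X. X \<in> G \<Longrightarrow> sts (g + s) (X \<union> S) (C X)" "\<And>X. X \<in> G \<Longrightarrow> D \<subseteq> C X"
  shows "sts (g * n + s) (V \<union> S) (B \<union> D \<union> (\<Union>X\<in>G. C X))"
proof -
  let ?E = "B \<union> D \<union> (\<Union>X\<in>G. C X)"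
  note V = gdd3D(1-3)[OF gdd] and cardX = gdd3D(4)[OF gdd] and sub = gdd3_group_subset[OF gdd]
  have Csub: "b \<subseteq> X \<union> S" "card b = 3" if "X \<in> G" "b \<in> C X" for X b
    using C(1)[OF that(1)] that(2) by (simp_all add: sts_def)
  have Cpair: "\<exists>!b. b \<in> C X \<and> p \<in> b \<and> q \<in> b" if "X \<in> G" "p \<in> X \<union> S" "q \<in> X \<union> S" "p \<noteq> q" for X p q
    by (rule sts_pair[OF C(1)]) (fact that)+
  have Dsub: "b \<subseteq> S" "card b = 3" if "b \<in> D" for b
    using S(2) that by (simp_all add: sts_def)
  have finG: "finite G" using finite_elements[OF V(1,2)] .
  have "card V = sum card G"
    using V partition_onD1[OF V(2)] partition_onD2[OF V(2)] finG sub
    by (metis card_Union_disjoint finite_subset)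
  then have "card V = g * n" using cardX V by simp
  have finS: "finite S" "card S = s" using S(2) by (simp_all add: sts_def)
  with \<open>card V = g * n\<close> have card: "card (V \<union> S) = g * n + s" and fin: "finite (V \<union> S)"
    using S(1) V(1) finS by (simp_all add: card_Un_disjoint Int_commute)
  \<comment> \<open>A block through \<open>p\<close> and \<open>q\<close> cannot come from
    \<open>B\<close>, whose blocks avoid \<open>S\<close> and meet \<open>X\<close> at most once,
    nor from \<open>D\<close> or another copy, whose blocks avoid \<open>p\<close>.\<close>
  have same: "\<exists>!b. b \<in> ?E \<and> p \<in> b \<and> q \<in> b"
    if X: "X \<in> G" and p: "p \<in> X" and q: "q \<in> X \<union> S" "p \<noteq> q" for X p q
  proof -
    have pS: "p \<notin> S" using p X sub S by blast
    obtain c where c: "c \<in> C X" "p \<in> c" "q \<in> c"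
      and uniq: "\<And>b. b \<in> C X \<Longrightarrow> p \<in> b \<Longrightarrow> q \<in> b \<Longrightarrow> b = c"
      using Cpair[OF X, of p q] p q by blast
    have "b = c" if b: "b \<in> ?E" "p \<in> b" "q \<in> b" for b
    proof -
      consider "b \<in> B" | "b \<in> D" | Y where "Y \<in> G" "b \<in> C Y" using b by blast
      then show ?thesis
      proof cases
        case 1
        then have "q \<in> X" using q gdd3D(5)[OF gdd] b S by blast
        then show ?thesis using gdd3_block_group[OF gdd 1 X] b p q by blast
      next
        case 2
        then show ?thesis using Dsub b pS by blast
      next
        case 3
        then have "p \<in> Y" using Csub b pS by blast
        then have "Y = X" using partition_on_same[OF V(2)] X 3 p by blast
        then show ?thesis using uniq 3 b by blast
      qed
    qed
    then show ?thesis using c X by (intro ex1I[of _ c]) blast+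
  qed
  show ?thesis unfolding sts_def
  proof (intro conjI ballI impI)
    fix b assume b: "b \<in> ?E"
    then show "b \<subseteq> V \<union> S" using gdd3D(5)[OF gdd] Dsub Csub sub by blast
    show "card b = 3" using b gdd3D(6)[OF gdd] Dsub Csub by blast
  next
    fix p q assume pq: "p \<in> V \<union> S" "q \<in> V \<union> S" "p \<noteq> q"
    have grp: "\<exists>X\<in>G. x \<in> X" if "x \<in> V" for x using that partition_onD1[OF V(2)] by blast
    consider X where "X \<in> G" "p \<in> X" "q \<in> X \<union> S" | X where "X \<in> G" "q \<in> X" "p \<in> X \<union> S"
      | X Y where "X \<in> G" "Y \<in> G" "X \<noteq> Y" "p \<in> X" "q \<in> Y" | "p \<in> S" "q \<in> S"
    proof -
      consider "p \<in> V" "q \<in> V" | "p \<in> V" "q \<in> S" | "p \<in> S" "q \<in> V" | "p \<in> S" "q \<in> S"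
        using pq(1,2) by blast
      then show thesis
      proof cases
        case 1
        then show thesis using grp that(1,3) by (metis UnI1)
      qed (use grp that in \<open>metis UnI2\<close>)+
    qed
    then show "\<exists>!b. b \<in> ?E \<and> p \<in> b \<and> q \<in> b"
    proof cases
      case 1
      show ?thesis by (rule same[OF 1 pq(3)])
    next
      case 2
      have "\<exists>!b. b \<in> ?E \<and> q \<in> b \<and> p \<in> b" by (rule same[OF 2 pq(3)[symmetric]])
      then show ?thesis by (simp add: conj_commute)
    next
      case 3
      have nS: "p \<notin> S" "q \<notin> S" using 3 sub S by blast+
      obtain c where c: "c \<in> B" "p \<in> c" "q \<in> c"
        and uniq: "\<And>b. b \<in> B \<Longrightarrow> p \<in> b \<Longrightarrow> q \<in> b \<Longrightarrow> b = c"
        using gdd3D(8)[OF gdd 3] by blast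
      have "b = c" if b: "b \<in> ?E" "p \<in> b" "q \<in> b" for b
      proof -
        have "b \<notin> C Z" if "Z \<in> G" for Z
        proof
          assume "b \<in> C Z"
          then have "p \<in> Z" "q \<in> Z" using Csub[OF that] b nS by blast+
          then have "Z = X" "Z = Y" using partition_on_same[OF V(2)] 3 that by blast+
          then show False using 3 by blast
        qed
        then show ?thesis using uniq b Dsub nS by blast
      qed
      then show ?thesis using c by (intro ex1I[of _ c]) blast+
    next
      case 4
      obtain c where c: "c \<in> D" "p \<in> c" "q \<in> c"
        and uniq: "\<And>b. b \<in> D \<Longrightarrow> p \<in> b \<Longrightarrow> q \<in> b \<Longrightarrow> b = c"
        using sts_pair[OF S(2) 4 pq(3)] by blast
      have "b = c" if b: "b \<in> ?E" "p \<in> b" "q \<in> b" for b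
      proof -
        have "b \<notin> B" using 4 b S gdd3D(5)[OF gdd] by blast
        \<comment> \<open>\<open>c\<close> lies in every copy because \<open>D\<close> does, so the
          pair property inside \<open>C X\<close> leaves no other block.\<close>
        moreover have "b = c" if X: "X \<in> G" "b \<in> C X" for X
          using Cpair[OF X(1), of p q] 4 pq(3) X b c C(2)[OF X(1)] by blast
        ultimately show ?thesis using uniq b by blast
      qed
      then show ?thesis using c by (intro ex1I[of _ c]) blast+
    qed
  qed (fact fin card)+
qed

text \<open>A frame class missing \<open>X\<close> covers \<open>V - X\<close> and a class of the
  copy covers \<open>X \<union> S\<close>, so a matched pair is a parallel class. No block is used
  twice: frame blocks occur in no copy, and the only block that different copies share is
  \<open>S\<close>, which lies in the unmatched classes \<open>Q X\<close>.\<close>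

lemma resolvable_fill:
  assumes frame: "kirkman_frame h n V G B" and "h > 0" "n \<ge> 2"
    and S: "S \<inter> V = {}" "card S = 3"
    and C: "\<And>X. X \<in> G \<Longrightarrow> kts (h + 3) (X \<union> S) (C X)" "\<And>X. X \<in> G \<Longrightarrow> S \<in> C X"
  shows "resolvable (V \<union> S) (B \<union> {S} \<union> (\<Union>X\<in>G. C X))"
proof -
  obtain R where gdd: "gdd3 h n V G B"
    and R: "partition_on B R" "\<forall>P\<in>R. \<exists>X\<in>G. partition_on (V - X) P"
    using frame by (auto simp: kirkman_frame_def)
  note V = gdd3D(1-3)[OF gdd] and cardX = gdd3D(4)[OF gdd] and sub = gdd3_group_subset[OF gdd]
  define F where "F X = {P\<in>R. partition_on (V - X) P}" for X
  have Fcard: "2 * card (F X) = h" if "X \<in> G" for X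
    unfolding F_def by (rule kirkman_frame_card_classes[OF gdd assms(2,3) R that])
  have Csub: "b \<subseteq> X \<union> S" "card b = 3" if "X \<in> G" "b \<in> C X" for X b
    using C(1)[OF that(1)] that(2) by (simp_all add: kts_def sts_def)
  \<comment> \<open>\<open>K\<close> bundles the resolution, the class containing \<open>S\<close>
    and the matching, so that one choice per group supplies all three.\<close>
  define K where "K X \<rho> Q \<beta> \<longleftrightarrow> partition_on (C X) \<rho> \<and> (\<forall>P\<in>\<rho>. partition_on (X \<union> S) P) \<and>
    Q \<in> \<rho> \<and> S \<in> Q \<and> bij_betw \<beta> (F X) (\<rho> - {Q})" for X \<rho> Q \<beta>
  have "\<exists>\<rho> Q \<beta>. K X \<rho> Q \<beta>" if X: "X \<in> G" for X
  proof -
    obtain \<rho> where \<rho>: "partition_on (C X) \<rho>" "\<forall>P\<in>\<rho>. partition_on (X \<union> S) P"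
      using C(1)[OF X] by (auto simp: kts_def resolvable_def)
    obtain Q where Q: "Q \<in> \<rho>" "S \<in> Q" using C(2)[OF X] partition_onD1[OF \<rho>(1)] by blast
    \<comment> \<open>As \<open>h\<close> is twice \<open>card (F X)\<close>, the copy has exactly
      one class more than there are frame classes missing \<open>X\<close>; removing
      \<open>Q\<close> balances the two.\<close>
    have "h + 3 = 2 * (card (F X) + 1) + 1" using Fcard[OF X] by simp
    then have "sts (2 * (card (F X) + 1) + 1) (X \<union> S) (C X)"
      using C(1)[OF X] unfolding kts_def by metis
    from kts_card_classes[OF this \<rho>] have "card \<rho> = card (F X) + 1" .
    moreover have "finite \<rho>" using calculation by (metis add_is_0 card.infinite one_neq_zero)
    ultimately have "card (F X) = card (\<rho> - {Q})" using Q by simp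
    \<comment> \<open>An infinite set would have cardinality 0, against
      \<open>h > 0\<close>.\<close>
    moreover have "finite (F X)" using Fcard[OF X] \<open>h > 0\<close> by (metis card.infinite mult_0_right not_less0)
    ultimately obtain \<beta> where "bij_betw \<beta> (F X) (\<rho> - {Q})"
      using \<open>finite \<rho>\<close> finite_same_card_bij by blast
    then show ?thesis using \<rho> Q unfolding K_def by blast
  qed
  then obtain \<rho> Q \<beta> where "\<And>X. X \<in> G \<Longrightarrow> K X (\<rho> X) (Q X) (\<beta> X)" by metis
  then have \<rho>: "partition_on (C X) (\<rho> X)" "P \<in> \<rho> X \<Longrightarrow> partition_on (X \<union> S) P"
    and Q: "Q X \<in> \<rho> X" "S \<in> Q X" and \<beta>: "bij_betw (\<beta> X) (F X) (\<rho> X - {Q X})"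
    if "X \<in> G" for X P using that unfolding K_def by blast+
  have \<beta>in: "\<beta> X P \<in> \<rho> X" "\<beta> X P \<noteq> Q X" if "X \<in> G" "P \<in> F X" for X P
    using \<beta>[OF that(1)] that(2) by (auto dest: bij_betwE)
  have \<beta>C: "c \<in> C X" "c \<notin> Q X" "c \<noteq> S" if "X \<in> G" "P \<in> F X" "c \<in> \<beta> X P" for X P c
    using \<beta>in[OF that(1,2)] \<rho>(1)[OF that(1)] that(3) Q[OF that(1)]
    by (blast dest: partition_onD1 partition_on_same)+
  have QC: "Q X \<subseteq> C X" if "X \<in> G" for X
    using partition_onD1[OF \<rho>(1)] Q that by blast
  have FB: "P \<subseteq> B" if "P \<in> F X" for P X
    using that partition_onD1[OF R(1)] unfolding F_def by blast
  have SB: "S \<notin> B" 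
  proof
    assume "S \<in> B"
    then have "S = {}" using S(1) gdd3D(5)[OF gdd] by blast
    then show False using S(2) by simp
  qed
  \<comment> \<open>A shared block would lie in \<open>V\<close> and in \<open>X \<union> S\<close>,
    hence have all three points in the group \<open>X\<close>.\<close>
  have BC: False if "X \<in> G" "b \<in> B" "b \<in> C X" for X b
  proof -
    have "b \<inter> X = b" using Csub[OF that(1,3)] gdd3D(5)[OF gdd that(2)] S by blast
    then show False using gdd3D(6,7)[OF gdd that(2)] that(1) by fastforce
  qed
  \<comment> \<open>Such a block lies inside \<open>S\<close>, and both have three elements.\<close>
  have CC: "b = S" if "X \<in> G" "Y \<in> G" "X \<noteq> Y" "b \<in> C X" "b \<in> C Y" for X Y b
  proof (rule card_subset_eq)
    have "X \<inter> Y = {}" by (rule disjointD[OF partition_onD2[OF V(2)] that(1-3)])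
    then show "b \<subseteq> S" using Csub(1)[OF that(1,4)] Csub(1)[OF that(2,5)] by blast
    show "card b = card S" using Csub(2)[OF that(1,4)] S(2) by simp
    show "finite S" by (rule card_ge_0_finite) (simp add: S)
  qed
  define cls where "cls X P = P \<union> \<beta> X P" for X P
  \<comment> \<open>Without \<open>S\<close> the class \<open>Q X\<close> partitions just
    \<open>X\<close>; the common block \<open>S\<close> is put back once.\<close>
  define F0 where "F0 = {S} \<union> (\<Union>X\<in>G. Q X - {S})"
  have cls_F0: False if X: "X \<in> G" and P: "P \<in> F X" and c: "c \<in> cls X P" "c \<in> F0" for X P c
  proof -
    consider "c \<in> B" | "c \<in> \<beta> X P"
      using c(1) FB[OF P] unfolding cls_def by blast
    then show False
    proof cases
      case 1
      then obtain Y where "Y \<in> G" "c \<in> Q Y" using c(2) SB unfolding F0_def by blast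
      then show False using BC[OF _ 1] QC by blast
    next
      case 2
      note cX = \<beta>C[OF X P 2]
      then obtain Y where Y: "Y \<in> G" "c \<in> Q Y" using c(2) unfolding F0_def by blast
      then have "c = S" if "X \<noteq> Y" using CC[OF X _ that cX(1)] QC by blast
      then show False using cX Y(2) by blast
    qed
  qed
  \<comment> \<open>A shared block lies in both frame classes or in both copy classes. The former
    forces equal classes and hence equal missed groups. The latter forces equal groups by
    \<open>CC\<close>, as the block is not \<open>S\<close>, and then equal classes because
    \<open>\<beta> X\<close> is injective.\<close>
  have cls_cls: "X = Y \<and> P = P'"
    if XY: "X \<in> G" "Y \<in> G" and P: "P \<in> F X" "P' \<in> F Y" and c: "c \<in> cls X P" "c \<in> cls Y P'" for X Y P P' c
  proof -
    consider "c \<in> P" "c \<in> P'" | "c \<in> \<beta> X P" "c \<in> \<beta> Y P'"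
      using c FB[OF P(1)] FB[OF P(2)] \<beta>C(1)[OF XY(1) P(1)] \<beta>C(1)[OF XY(2) P(2)]
        BC[OF XY(1)] BC[OF XY(2)] unfolding cls_def by blast
    then show ?thesis
    proof cases
      case 1
      have "P \<in> R" "P' \<in> R" using P unfolding F_def by blast+
      then have "P = P'" using 1 partition_on_same[OF R(1)] by blast
      then show ?thesis
        using P XY partition_on_Diff_unique[OF _ _ sub[OF XY(1)] sub[OF XY(2)], of P]
        unfolding F_def by simp
    next
      case 2
      note C1 = \<beta>C[OF XY(1) P(1) 2(1)] and C2 = \<beta>C[OF XY(2) P(2) 2(2)]
      have "X = Y" using CC[OF XY _ C1(1) C2(1)] C1(3) by blast
      moreover have "\<beta> X P = \<beta> X P'"
        using partition_on_same[OF \<rho>(1)[OF XY(1)] \<beta>in(1)[OF XY(1) P(1)] _ 2(1)]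
          \<beta>in(1)[OF XY(2) P(2)] 2(2) \<open>X = Y\<close> by simp
      ultimately show ?thesis using \<beta>[OF XY(1)] P by (auto simp: bij_betw_def inj_on_def)
    qed
  qed
  define Rf where "Rf = insert F0 (\<Union>X\<in>G. cls X ` F X)"
  have "partition_on (B \<union> {S} \<union> (\<Union>X\<in>G. C X)) Rf"
  proof (rule partition_onI)
    \<comment> \<open>Every frame class misses some group, so the sets \<open>F X\<close> exhaust
      the resolution.\<close>
    have "(\<Union>X\<in>G. F X) = R" using R(2) unfolding F_def by blast
    then have B_eq: "(\<Union>X\<in>G. \<Union>(F X)) = B" using partition_onD1[OF R(1)] by auto
    have "C X = Q X \<union> (\<Union>P\<in>F X. \<beta> X P)" if "X \<in> G" for X
    proof -
      have "\<rho> X = insert (Q X) (\<beta> X ` F X)"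
        using \<beta>[OF that] Q[OF that] by (auto simp: bij_betw_def)
      then show ?thesis using partition_onD1[OF \<rho>(1)[OF that]] by simp
    qed
    then have "(\<Union>X\<in>G. C X) = (\<Union>X\<in>G. Q X \<union> (\<Union>P\<in>F X. \<beta> X P))"
      by (rule SUP_cong[OF refl])
    then have C_eq: "(\<Union>X\<in>G. C X) = (\<Union>X\<in>G. Q X) \<union> (\<Union>X\<in>G. \<Union>P\<in>F X. \<beta> X P)"
      by (simp add: UN_Un_distrib)
    have "F0 = {S} \<union> (\<Union>X\<in>G. Q X)" unfolding F0_def by blast
    moreover have "(\<Union>X\<in>G. \<Union>P\<in>F X. cls X P) =
        (\<Union>X\<in>G. \<Union>(F X)) \<union> (\<Union>X\<in>G. \<Union>P\<in>F X. \<beta> X P)"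
      unfolding cls_def by (simp add: UN_Un_distrib)
    moreover have "\<Union>Rf = F0 \<union> (\<Union>X\<in>G. \<Union>P\<in>F X. cls X P)"
      unfolding Rf_def by auto
    ultimately have "\<Union>Rf = {S} \<union> (\<Union>X\<in>G. Q X) \<union>
        ((\<Union>X\<in>G. \<Union>(F X)) \<union> (\<Union>X\<in>G. \<Union>P\<in>F X. \<beta> X P))"
      by simp
    then show "\<Union>Rf = B \<union> {S} \<union> (\<Union>X\<in>G. C X)" by (simp only: B_eq C_eq Un_ac)
    fix p q assume "p \<in> Rf" "q \<in> Rf" "p \<noteq> q"
    then consider "p = F0" "\<exists>X\<in>G. \<exists>P\<in>F X. q = cls X P"
      | "q = F0" "\<exists>X\<in>G. \<exists>P\<in>F X. p = cls X P"
      | "\<exists>X\<in>G. \<exists>P\<in>F X. p = cls X P" "\<exists>X\<in>G. \<exists>P\<in>F X. q = cls X P"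
      unfolding Rf_def by blast
    then show "disjnt p q"
    proof cases
      case 3
      then obtain X Y P P' where "X \<in> G" "P \<in> F X" "Y \<in> G" "P' \<in> F Y"
        and pq: "p = cls X P" "q = cls Y P'" by blast
      then have "X = Y \<and> P = P'" if "c \<in> p" "c \<in> q" for c
        using cls_cls[of X Y P P' c] that by simp
      then show ?thesis using \<open>p \<noteq> q\<close> pq unfolding disjnt_def by blast
    qed (use cls_F0 in \<open>auto simp: disjnt_def\<close>)
  next
    have "cls X P \<noteq> {}" if "P \<in> F X" for X P
      using that partition_onD3[OF R(1)] unfolding F_def cls_def by blast
    then show "{} \<notin> Rf" unfolding Rf_def F0_def by blast
  qed
  moreover have "partition_on (V \<union> S) (cls X P)" if X: "X \<in> G" "P \<in> F X" for X P
  proof -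
    have "partition_on ((V - X) \<union> (X \<union> S)) (cls X P)"
      unfolding cls_def
      by (rule partition_on_Un) (use X S \<rho>(2) \<beta>in in \<open>auto simp: F_def\<close>)
    moreover have "(V - X) \<union> (X \<union> S) = V \<union> S" using sub[OF X(1)] by blast
    ultimately show ?thesis by simp
  qed
  moreover have "partition_on (V \<union> S) F0"
  proof -
    have "partition_on X (Q X - {S})" if X: "X \<in> G" for X
    proof -
      have "X \<union> S - S = X" using sub[OF X] S by blast
      then show ?thesis using partition_on_remove[OF \<rho>(2)[OF X Q(1)[OF X]] Q(2)[OF X]] by simp
    qed
    then have "partition_on V (\<Union>X\<in>G. Q X - {S})" by (rule partition_on_UN[OF V(2)])
    moreover have "partition_on S {S}" using S by (intro partition_on_space) auto
    ultimately show ?thesis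
      unfolding F0_def using S(1) by (metis Un_commute partition_on_Un)
  qed
  ultimately show ?thesis unfolding resolvable_def Rf_def by blast
qed

section \<open>Placing copies of the MK and filling the frame with them\<close>

text \<open>A bijection of the subsets is glued to one of the complements. This prescribes the image
  of a subset when a copy of a design is placed.\<close>

lemma finite_bij_betw_extend:
  assumes "finite A" "finite A'" "C \<subseteq> A" "C' \<subseteq> A'" "card A = card A'" "card C = card C'"
  shows "\<exists>h. bij_betw h A A' \<and> h ` C = C'"
proof -
  have fin: "finite C" "finite C'" using assms finite_subset by blast+
  obtain h1 where h1: "bij_betw h1 C C'"
    using finite_same_card_bij[OF fin assms(6)] by blast
  have "card (A - C) = card (A' - C')" using assms fin by (simp add: card_Diff_subset)
  then obtain h2 where h2: "bij_betw h2 (A - C) (A' - C')"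
    using finite_same_card_bij assms(1,2) by blast
  let ?h = "\<lambda>x. if x \<in> C then h1 x else h2 x"
  have "bij_betw ?h (C \<union> (A - C)) (C' \<union> (A' - C'))"
    by (rule bij_betw_disjoint_Un[OF h1 h2]) blast+
  moreover have "?h ` C = C'" using bij_betw_imp_surj_on[OF h1] by auto
  moreover have "C \<union> (A - C) = A" "C' \<union> (A' - C') = A'" using assms(3,4) by blast+
  ultimately show ?thesis by metis
qed

text \<open>\<open>MK\<close> asks for natural numbers as points, whereas the construction lives on
  pairs; a countable point type is encoded by \<open>to_nat\<close>.\<close>

lemma MK_I:
  fixes V :: "'a :: countable set"
  assumes "kts (2 * w + 1) V B" "W \<subseteq> V" "A \<subseteq> B" "sts w W A"
  shows "MK (2 * w + 1)"
  unfolding MK_def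
proof (intro exI conjI)
  show "kts (2 * w + 1) (to_nat ` V) ((`) to_nat ` B)"
    using assms(1) by (rule kts_image) (auto intro: inj_on_subset)
  show "sts w (to_nat ` W) ((`) to_nat ` A)"
    using assms(4) by (rule sts_image) (auto intro: inj_on_subset)
qed (use assms(2,3) in auto)

text \<open>Filling is done twice: on the frame with the three points of \<open>S\<close>, and on
  the sub-GDD with a single point \<open>a\<close> of \<open>S\<close>. The second system has
  \<open>k * n + 1\<close> points, as required of a subsystem on \<open>2 * k * n + 3\<close>
  points. The infinite point type leaves room for \<open>S\<close> outside \<open>V\<close>.\<close>

lemma MK_fill:
  fixes V :: "'a :: countable set"
  assumes frame: "kirkman_frame (2 * k) n V G B" and sub: "gdd3 k n W H A" "gdd_subdesign H A G B"
    and MK: "MK (2 * k + 3)" and "infinite (UNIV :: 'a set)" "k > 0" "n \<ge> 2"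
  shows "MK (2 * k * n + 3)"
proof -
  have gdd: "gdd3 (2 * k) n V G B" using frame by (simp add: kirkman_frame_def)
  note V = gdd3D(1,2)[OF gdd] and sub_V = gdd3_group_subset[OF gdd]
  obtain f where f: "bij_betw f G H" "\<And>X. X \<in> G \<Longrightarrow> f X \<subseteq> X" and "A \<subseteq> B"
    using sub(2) by (auto simp: gdd_subdesign_def)
  have fH: "f X \<in> H" if "X \<in> G" for X using bij_betwE[OF f(1)] that by blast
  obtain V0 :: "nat set" and B0 W0 A0 w where kts0: "kts (2 * k + 3) V0 B0"
    and w: "2 * k + 3 = 2 * w + 1" and W0: "W0 \<subseteq> V0" and A0: "A0 \<subseteq> B0" and stsw: "sts w W0 A0"
    using MK unfolding MK_def by blast
  have "w = k + 1" using w by simp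
  then have sts0: "sts (2 * k + 3) V0 B0" "sts (k + 1) W0 A0"
    using kts0 stsw by (simp_all add: kts_def)
  have fin0: "finite V0" "card V0 = 2 * k + 3" "finite W0" "card W0 = k + 1"
    using sts0 by (simp_all add: sts_def)
  have "W0 \<noteq> {}" using fin0 by auto
  then obtain x where x: "x \<in> W0" by blast
  have "card (V0 - W0) = k + 2" using fin0 W0 by (simp add: card_Diff_subset)
  then have "V0 - W0 \<noteq> {}" by (metis add_is_0 card.empty zero_neq_numeral)
  then obtain y where y: "y \<in> V0" "y \<notin> W0" by blast
  have xV: "x \<in> V0" "x \<noteq> y" using x y W0 by auto
  obtain b0 where b0: "b0 \<in> B0" "x \<in> b0" "y \<in> b0"
    using sts_pair[OF sts0(1) xV(1) y(1) xV(2)] by blast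
  have b0V: "b0 \<subseteq> V0" "card b0 = 3" using b0(1) sts0(1) by (simp_all add: sts_def)
  \<comment> \<open>Another point of \<open>b0\<close> in \<open>W0\<close> would be joined to
    \<open>x\<close> by a block of \<open>A0\<close>; by uniqueness this is \<open>b0\<close>, which
    would then lie inside \<open>W0\<close> and could not contain \<open>y\<close>.\<close>
  have b0W: "b0 - {x} \<subseteq> V0 - W0"
  proof
    fix z assume z: "z \<in> b0 - {x}"
    have "z \<notin> W0"
    proof
      assume zW: "z \<in> W0"
      have "x \<noteq> z" using z by blast
      then obtain a where a: "a \<in> A0" "x \<in> a" "z \<in> a"
        using sts_pair[OF sts0(2) x zW] by blast
      have "z \<in> V0" using zW W0 by blast
      from sts_pair[OF sts0(1) xV(1) this \<open>x \<noteq> z\<close>] have "a = b0"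
        using a b0 z A0 by blast
      then show False using y b0(3) a(1) sts_blocks[OF sts0(2)] by blast
    qed
    then show "z \<in> V0 - W0" using z b0V by blast
  qed
  have "infinite (- V)" using assms(5) V(1) by (metis Compl_eq_Diff_UNIV finite_Diff2)
  then obtain S where S: "finite S" "card S = 3" "S \<subseteq> - V"
    using infinite_arbitrarily_large by blast
  then have SV: "S \<inter> V = {}" by blast
  have "S \<noteq> {}" using S by auto
  \<comment> \<open>The same \<open>a\<close> serves every group, since the copies of the subsystem
    have to share it.\<close>
  then obtain a where a: "a \<in> S" by blast
  \<comment> \<open>\<open>\<theta>\<close> is glued from a map of the \<open>k + 1\<close> points
    of \<open>W0\<close> that sends \<open>x\<close> to \<open>a\<close>, and a map of the other
    \<open>k + 2\<close> points that sends the rest of \<open>b0\<close> to the rest of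
    \<open>S\<close>.\<close>
  have "\<exists>\<theta>. bij_betw \<theta> V0 (X \<union> S) \<and> \<theta> ` W0 = f X \<union> {a} \<and> \<theta> ` b0 = S" if X: "X \<in> G" for X
  proof -
    have fin: "finite X" "finite (f X)"
      using sub_V[OF X] V(1) f(2)[OF X] by (meson finite_subset)+
    have cX: "card X = 2 * k" "card (f X) = k"
      using gdd3D(4)[OF gdd X] gdd3D(4)[OF sub(1) fH[OF X]] by simp_all
    have XS: "X \<inter> S = {}" using sub_V[OF X] SV by blast
    have anf: "a \<notin> f X" using XS f(2)[OF X] a by blast
    have "\<exists>h. bij_betw h W0 (f X \<union> {a}) \<and> h ` {x} = {a}"
      by (rule finite_bij_betw_extend) (use fin0 fin cX x anf in simp_all)
    then obtain h1 where h1: "bij_betw h1 W0 (f X \<union> {a})" "h1 ` {x} = {a}" by blast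
    have "\<exists>h. bij_betw h (V0 - W0) ((X - f X) \<union> (S - {a})) \<and> h ` (b0 - {x}) = S - {a}"
    proof (rule finite_bij_betw_extend)
      have "card (X - f X) = k" using cX fin f(2)[OF X] by (simp add: card_Diff_subset)
      moreover have "card (S - {a}) = 2" using S a by simp
      moreover have "card ((X - f X) \<union> (S - {a})) = card (X - f X) + card (S - {a})"
        by (rule card_Un_disjoint) (use fin S XS in auto)
      ultimately show "card (V0 - W0) = card ((X - f X) \<union> (S - {a}))"
        using \<open>card (V0 - W0) = k + 2\<close> by simp
      show "card (b0 - {x}) = card (S - {a})" using b0V b0 S a by simp
    qed (use fin0 fin S b0W in simp_all)
    then obtain h2 where h2: "bij_betw h2 (V0 - W0) ((X - f X) \<union> (S - {a}))"
      "h2 ` (b0 - {x}) = S - {a}" by blast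
    let ?\<theta> = "\<lambda>p. if p \<in> W0 then h1 p else h2 p"
    have "bij_betw ?\<theta> (W0 \<union> (V0 - W0)) ((f X \<union> {a}) \<union> ((X - f X) \<union> (S - {a})))"
      by (rule bij_betw_disjoint_Un[OF h1(1) h2(1)]) (use XS f(2)[OF X] a in blast)+
    moreover have "W0 \<union> (V0 - W0) = V0" using W0 by blast
    moreover have "(f X \<union> {a}) \<union> ((X - f X) \<union> (S - {a})) = X \<union> S" using f(2)[OF X] a by blast
    ultimately have "bij_betw ?\<theta> V0 (X \<union> S)" by simp
    moreover have "?\<theta> ` W0 = f X \<union> {a}" using bij_betw_imp_surj_on[OF h1(1)] by simp
    moreover have "?\<theta> ` b0 = S"
    proof -
      have "?\<theta> ` b0 = ?\<theta> ` {x} \<union> ?\<theta> ` (b0 - {x})" using b0(2) by blast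
      also have "?\<theta> ` {x} = {a}" using h1(2) x by simp
      also have "?\<theta> ` (b0 - {x}) = h2 ` (b0 - {x})"
        by (rule image_cong) (use b0W in auto)
      finally have "?\<theta> ` b0 = {a} \<union> (S - {a})" unfolding h2(2) .
      moreover have "{a} \<union> (S - {a}) = S" using a by blast
      ultimately show ?thesis by simp
    qed
    ultimately show ?thesis by blast
  qed
  then obtain \<theta> where \<theta>: "\<And>X. X \<in> G \<Longrightarrow> bij_betw (\<theta> X) V0 (X \<union> S)"
    "\<And>X. X \<in> G \<Longrightarrow> \<theta> X ` W0 = f X \<union> {a}" "\<And>X. X \<in> G \<Longrightarrow> \<theta> X ` b0 = S"
    by metis
  define C where "C X = (`) (\<theta> X) ` B0" for X
  define D where "D X = (`) (\<theta> X) ` A0" for X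
  have ktsC: "kts (2 * k + 3) (X \<union> S) (C X)" if "X \<in> G" for X
    using kts_image[OF kts0] \<theta>(1)[OF that] unfolding C_def bij_betw_def by metis
  then have stsC: "sts (2 * k + 3) (X \<union> S) (C X)" if "X \<in> G" for X
    using that by (simp add: kts_def)
  have SC: "S \<in> C X" if "X \<in> G" for X
    using \<theta>(3)[OF that] b0(1) unfolding C_def by blast
  have stsD: "sts (k + 1) (f X \<union> {a}) (D X)" if "X \<in> G" for X
    using sts_image[OF sts0(2), of "\<theta> X"] \<theta>(1,2)[OF that] W0 unfolding D_def bij_betw_def
    by (metis inj_on_subset)
  \<comment> \<open>The copies are indexed by the groups in \<open>G\<close>, the filling of the
    sub-GDD by those in \<open>H\<close>; the inverse of \<open>f\<close> translates.\<close>
  have inv: "inv_into G f Y \<in> G" "f (inv_into G f Y) = Y" if "Y \<in> H" for Y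
    using f(1) that by (auto simp: bij_betw_def inv_into_into f_inv_into_f)
  \<comment> \<open>The empty set in \<open>?A\<close> is the block set of the trivial STS on the
    point \<open>a\<close>, written out to match \<open>sts_fill\<close>.\<close>
  let ?B = "B \<union> {S} \<union> (\<Union>X\<in>G. C X)" and ?A = "A \<union> {} \<union> (\<Union>Y\<in>H. D (inv_into G f Y))"
  have "W \<subseteq> V"
  proof
    fix p assume "p \<in> W"
    then obtain Y where "Y \<in> H" "p \<in> Y" using partition_onD1[OF gdd3D(2)[OF sub(1)]] by blast
    then show "p \<in> V" using inv[of Y] f(2) sub_V by blast
  qed
  have stsS: "sts 3 S {S}" using S by (auto simp: sts_def)
  have sts1: "sts 1 {a} {}" by (simp add: sts_def)
  have "sts (2 * k * n + 3) (V \<union> S) ?B"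
    by (rule sts_fill[OF gdd SV stsS]) (use stsC SC in auto)
  moreover have "resolvable (V \<union> S) ?B"
    by (rule resolvable_fill[OF frame _ _ SV S(2)]) (use ktsC SC assms in auto)
  \<comment> \<open>In this form of \<open>2 * k * n + 3\<close> the size of the subsystem can be
    read off.\<close>
  ultimately have kts: "kts (2 * (k * n + 1) + 1) (V \<union> S) ?B"
    by (simp add: kts_def mult.assoc numeral_3_eq_3)
  have sts: "sts (k * n + 1) (W \<union> {a}) ?A"
  proof (rule sts_fill[OF sub(1) _ sts1])
    show "{a} \<inter> W = {}" using \<open>W \<subseteq> V\<close> SV a by blast
    show "sts (k + 1) (Y \<union> {a}) (D (inv_into G f Y))" if "Y \<in> H" for Y
      using stsD[OF inv(1)[OF that]] inv(2)[OF that] by simp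
  qed simp
  have W: "W \<union> {a} \<subseteq> V \<union> S" using \<open>W \<subseteq> V\<close> a by blast
  have A: "?A \<subseteq> ?B"
  proof -
    have "D X \<subseteq> C X" for X using A0 unfolding C_def D_def by blast
    then show ?thesis using \<open>A \<subseteq> B\<close> inv(1) by blast
  qed
  from MK_I[OF kts W A sts] show ?thesis by (simp add: mult.assoc numeral_3_eq_3)
qed

section \<open>Inflating GDDs and frames by a resolvable TD\<close>

text \<open>The three groups of the TD are matched with the three points of \<open>b\<close>, and
  each is mapped onto \<open>M\<close>. So groups become fibres of \<open>fst\<close>, and a block,
  with a point in each group, projects onto \<open>b\<close>. The pair property is restated through
  \<open>fst\<close>, which is how it meets the points of the inflated design.\<close>

lemma TD_on_block:
  assumes TD: "gdd3 m 3 U K T" and "card b = 3" "finite M" "card M = m"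
  shows "\<exists>\<psi>. bij_betw \<psi> U (b \<times> M) \<and> (\<forall>c\<in>T. fst ` \<psi> ` c = b) \<and>
    (\<forall>p\<in>U. \<forall>q\<in>U. fst (\<psi> p) \<noteq> fst (\<psi> q) \<longrightarrow> (\<exists>!c. c \<in> T \<and> p \<in> c \<and> q \<in> c))"
proof -
  note U = gdd3D(1-3)[OF TD] and cardK = gdd3D(4)[OF TD]
  have finb: "finite b" by (rule card_ge_0_finite) (simp add: assms)
  have "card K = card b" using U(3) assms(2) by simp
  then obtain e where e: "bij_betw e K b"
    using finite_same_card_bij[OF finite_elements[OF U(1,2)] finb] by blast
  have "\<exists>\<phi>. bij_betw \<phi> X M" if "X \<in> K" for X
    using finite_same_card_bij[of X M] gdd3_group_subset[OF TD that] U(1) cardK[OF that] assms(3,4)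
    by (metis finite_subset)
  then obtain \<phi> where \<phi>: "\<And>X. X \<in> K \<Longrightarrow> bij_betw (\<phi> X) X M" by metis
  have "\<exists>X. X \<in> K \<and> p \<in> X" if "p \<in> U" for p using that partition_onD1[OF U(2)] by blast
  then obtain \<kappa> where \<kappa>: "\<And>p. p \<in> U \<Longrightarrow> \<kappa> p \<in> K" "\<And>p. p \<in> U \<Longrightarrow> p \<in> \<kappa> p" by metis
  have KU: "p \<in> U" "\<kappa> p = X" if "X \<in> K" "p \<in> X" for X p
  proof -
    show "p \<in> U" using gdd3_group_subset[OF TD] that by blast
    then show "\<kappa> p = X" using partition_on_same[OF U(2) \<kappa>(1) that(1) \<kappa>(2) that(2)] by blast
  qed
  \<comment> \<open>\<open>\<kappa> p\<close> is the group of \<open>p\<close>; its partner under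
    \<open>e\<close> is the first coordinate, and \<open>\<phi>\<close> locates \<open>p\<close>
    within the group.\<close>
  define \<psi> where "\<psi> p = (e (\<kappa> p), \<phi> (\<kappa> p) p)" for p
  have einj: "X = Y" if "e X = e Y" "X \<in> K" "Y \<in> K" for X Y
    using e that by (auto simp: bij_betw_def inj_on_def)
  have "inj_on \<psi> U"
  proof (rule inj_onI)
    fix p q assume pq: "p \<in> U" "q \<in> U" "\<psi> p = \<psi> q"
    then have eq: "\<kappa> p = \<kappa> q" using einj \<kappa>(1) unfolding \<psi>_def by simp
    have "inj_on (\<phi> (\<kappa> p)) (\<kappa> p)" using \<phi> \<kappa>(1) pq(1) by (simp add: bij_betw_def)
    moreover have "q \<in> \<kappa> p" using \<kappa>(2) pq(2) eq by simp
    moreover have "\<phi> (\<kappa> p) p = \<phi> (\<kappa> p) q" using pq(3) eq unfolding \<psi>_def by simp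
    ultimately show "p = q" using \<kappa>(2)[OF pq(1)] by (blast dest: inj_onD)
  qed
  moreover have "\<psi> ` U = b \<times> M"
  proof (intro equalityI subsetI)
    fix z assume "z \<in> \<psi> ` U"
    then obtain p where p: "p \<in> U" "z = \<psi> p" by blast
    then show "z \<in> b \<times> M"
      using bij_betwE[OF e] bij_betwE[OF \<phi>[OF \<kappa>(1)[OF p(1)]]] \<kappa>[OF p(1)] unfolding \<psi>_def by simp
  next
    fix z assume z: "z \<in> b \<times> M"
    obtain X where X: "X \<in> K" "e X = fst z" using e z by (auto simp: bij_betw_def)
    obtain p where p: "p \<in> X" "\<phi> X p = snd z" using \<phi>[OF X(1)] z by (auto simp: bij_betw_def)
    have "\<psi> p = z" using KU(2)[OF X(1) p(1)] X p unfolding \<psi>_def by simp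
    then show "z \<in> \<psi> ` U" using KU(1)[OF X(1) p(1)] by blast
  qed
  moreover have "fst ` \<psi> ` c = b" if c: "c \<in> T" for c
  proof (rule card_subset_eq[OF finb])
    have cU: "c \<subseteq> U" using gdd3D(5)[OF TD c] .
    then show "fst ` \<psi> ` c \<subseteq> b" using \<kappa>(1) bij_betwE[OF e] unfolding \<psi>_def by auto
    \<comment> \<open>A block meets each group at most once, so its points lie over different points
      of \<open>b\<close>; equal size then makes the projection onto.\<close>
    have "inj_on (fst \<circ> \<psi>) c"
    proof (rule inj_onI)
      fix p q assume pq: "p \<in> c" "q \<in> c" "(fst \<circ> \<psi>) p = (fst \<circ> \<psi>) q"
      then have U: "p \<in> U" "q \<in> U" using cU by blast+
      then have "\<kappa> p = \<kappa> q" using pq einj \<kappa>(1) unfolding \<psi>_def by simp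
      then have "q \<in> \<kappa> p" using \<kappa>(2) U by simp
      then show "p = q" using gdd3_block_group[OF TD c \<kappa>(1) pq(1,2) \<kappa>(2)] U by blast
    qed
    then show "card (fst ` \<psi> ` c) = card b"
      using card_image[of "fst \<circ> \<psi>" c] gdd3D(6)[OF TD c] assms(2) by (simp add: image_comp)
  qed
  moreover have "\<exists>!c. c \<in> T \<and> p \<in> c \<and> q \<in> c"
    if "p \<in> U" "q \<in> U" "fst (\<psi> p) \<noteq> fst (\<psi> q)" for p q
  proof -
    have "\<kappa> p \<noteq> \<kappa> q" using that(3) unfolding \<psi>_def by auto
    then show ?thesis using gdd3D(8)[OF TD] \<kappa> that by blast
  qed
  ultimately show ?thesis
    unfolding bij_betw_def by (intro exI[of _ \<psi>] conjI ballI impI) simp_all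
qed

lemma Times_right_cancel: "M \<noteq> {} \<Longrightarrow> X \<times> M = Y \<times> M \<longleftrightarrow> X = Y"
  by (metis fst_image_times)

lemma partition_on_Times:
  assumes "partition_on A P" "M \<noteq> {}"
  shows "partition_on (A \<times> M) ((\<lambda>X. X \<times> M) ` P)"
proof (rule partition_onI)
  show "\<Union>((\<lambda>X. X \<times> M) ` P) = A \<times> M" using partition_onD1[OF assms(1)] by blast
  fix p q assume "p \<in> (\<lambda>X. X \<times> M) ` P" "q \<in> (\<lambda>X. X \<times> M) ` P" "p \<noteq> q"
  then obtain X Y where XY: "X \<in> P" "Y \<in> P" "X \<noteq> Y" "p = X \<times> M" "q = Y \<times> M" by blast
  then have "X \<inter> Y = {}" using disjointD[OF partition_onD2[OF assms(1)]] by blast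
  then show "disjnt p q" using XY unfolding disjnt_def by blast
next
  show "{} \<notin> (\<lambda>X. X \<times> M) ` P"
  proof
    assume "{} \<in> (\<lambda>X. X \<times> M) ` P"
    then obtain X where "X \<in> P" "X \<times> M = {}" by (auto elim!: imageE)
    then show False using partition_onD3[OF assms(1)] assms(2) by (metis Times_empty)
  qed
qed

text \<open>The block projects onto the three points of \<open>b\<close>, so no two of its own three
  points share a first coordinate.\<close>

lemma inflated_block:
  assumes "bij_betw \<psi> U (b \<times> M)" "fst ` \<psi> ` c = b" "c \<subseteq> U" "card b = 3" "card c = 3"
  shows "\<psi> ` c \<subseteq> b \<times> M" "card (\<psi> ` c) = 3" "inj_on fst (\<psi> ` c)"
proof -
  show "\<psi> ` c \<subseteq> b \<times> M" using assms(1,3) by (auto simp: bij_betw_def)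
  show card: "card (\<psi> ` c) = 3"
    using assms(1,3,5) by (metis bij_betw_def card_image inj_on_subset)
  show "inj_on fst (\<psi> ` c)"
  proof (rule eq_card_imp_inj_on)
    show "finite (\<psi> ` c)" by (rule card_ge_0_finite) (simp add: card)
    show "card (fst ` (\<psi> ` c)) = card (\<psi> ` c)" unfolding assms(2) card assms(4) ..
  qed
qed

text \<open>Points of different inflated groups determine first the block of \<open>B\<close>
  through their projections, then the block of the TD copy over it. The copies \<open>\<psi>\<close>
  are a parameter so that a frame and its sub-GDD can be inflated with the same ones.\<close>

lemma gdd3_inflate:
  assumes gdd: "gdd3 g u V G B" and TD: "gdd3 m 3 U K T" and M: "finite M" "card M = m" "m > 0"
    and \<psi>: "\<And>b. b \<in> B \<Longrightarrow> bij_betw (\<psi> b) U (b \<times> M)"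
      "\<And>b c. b \<in> B \<Longrightarrow> c \<in> T \<Longrightarrow> fst ` \<psi> b ` c = b"
      "\<And>b p q. b \<in> B \<Longrightarrow> p \<in> U \<Longrightarrow> q \<in> U \<Longrightarrow> fst (\<psi> b p) \<noteq> fst (\<psi> b q)
        \<Longrightarrow> \<exists>!c. c \<in> T \<and> p \<in> c \<and> q \<in> c"
  shows "gdd3 (g * m) u (V \<times> M) ((\<lambda>X. X \<times> M) ` G) (\<Union>b\<in>B. (`) (\<psi> b) ` T)"
proof -
  let ?E = "\<Union>b\<in>B. (`) (\<psi> b) ` T"
  note V = gdd3D(1-3)[OF gdd]
  have M0: "M \<noteq> {}" using M by auto
  have blk: "\<psi> b ` c \<subseteq> b \<times> M" "card (\<psi> b ` c) = 3" "inj_on fst (\<psi> b ` c)"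
    if "b \<in> B" "c \<in> T" for b c
    using inflated_block[OF \<psi>(1)[OF that(1)] \<psi>(2)[OF that] gdd3D(5)[OF TD that(2)]
        gdd3D(6)[OF gdd that(1)] gdd3D(6)[OF TD that(2)]] .
  show ?thesis unfolding gdd3_def
  proof (intro conjI ballI impI)
    show "finite (V \<times> M)" using V M by simp
    show "partition_on (V \<times> M) ((\<lambda>X. X \<times> M) ` G)" by (rule partition_on_Times[OF V(2) M0])
    show "card ((\<lambda>X. X \<times> M) ` G) = u"
      using V(3) by (subst card_image) (auto simp: inj_on_def Times_right_cancel[OF M0])
    show "card Z = g * m" if "Z \<in> (\<lambda>X. X \<times> M) ` G" for Z
      using that gdd3D(4)[OF gdd] M by (auto simp: card_cartesian_product)
  next
    fix d assume "d \<in> ?E"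
    then obtain b c where bc: "b \<in> B" "c \<in> T" "d = \<psi> b ` c" by blast
    show "d \<subseteq> V \<times> M"
      unfolding bc(3) by (rule order_trans[OF blk(1)[OF bc(1,2)] Sigma_mono[OF gdd3D(5)[OF gdd bc(1)] order_refl]])
    show "card d = 3" using blk(2)[OF bc(1,2)] bc(3) by simp
    fix Z assume "Z \<in> (\<lambda>X. X \<times> M) ` G"
    then obtain X where X: "X \<in> G" "Z = X \<times> M" by blast
    \<comment> \<open>Thus \<open>fst\<close> embeds \<open>d \<inter> Z\<close> into
      \<open>b \<inter> X\<close>, and the bound is inherited from the original design.\<close>
    have "inj_on fst (d \<inter> Z)" using blk(3)[OF bc(1,2)] bc(3) by (auto intro: inj_on_subset)
    then have "card (d \<inter> Z) = card (fst ` (d \<inter> Z))" by (simp add: card_image)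
    also have "\<dots> \<le> card (b \<inter> X)"
    proof (rule card_mono)
      show "finite (b \<inter> X)" using gdd3D(5)[OF gdd bc(1)] V(1) by (meson finite_Int finite_subset)
      show "fst ` (d \<inter> Z) \<subseteq> b \<inter> X" using blk(1)[OF bc(1,2)] bc(3) X by auto
    qed
    also have "\<dots> \<le> 1" by (rule gdd3D(7)[OF gdd bc(1) X(1)])
    finally show "card (d \<inter> Z) \<le> 1" .
  next
    fix Z Z' p q assume ZZ: "Z \<in> (\<lambda>X. X \<times> M) ` G" "Z' \<in> (\<lambda>X. X \<times> M) ` G" "Z \<noteq> Z'"
      and pq: "p \<in> Z" "q \<in> Z'"
    then obtain X Y where XY: "X \<in> G" "Y \<in> G" "X \<noteq> Y" "Z = X \<times> M" "Z' = Y \<times> M" by blast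
    have pX: "fst p \<in> X" "fst q \<in> Y" and pM: "snd p \<in> M" "snd q \<in> M" using pq XY by auto
    obtain b where b: "b \<in> B" "fst p \<in> b" "fst q \<in> b"
      and b_uniq: "\<And>b'. b' \<in> B \<Longrightarrow> fst p \<in> b' \<Longrightarrow> fst q \<in> b' \<Longrightarrow> b' = b"
      using gdd3D(8)[OF gdd XY(1-3) pX] by blast
    have "p \<in> \<psi> b ` U" "q \<in> \<psi> b ` U"
      using b pM bij_betw_imp_surj_on[OF \<psi>(1)[OF b(1)]] by (simp_all add: mem_Times_iff)
    then obtain p' q' where p': "p' \<in> U" "p = \<psi> b p'" and q': "q' \<in> U" "q = \<psi> b q'" by blast
    have inj: "inj_on (\<psi> b) U" using \<psi>(1)[OF b(1)] by (simp add: bij_betw_def)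
    have "fst p \<noteq> fst q"
      using pX XY(1-3) partition_on_same[OF V(2)] by metis
    then obtain c where c: "c \<in> T" "p' \<in> c" "q' \<in> c"
      and c_uniq: "\<And>c'. c' \<in> T \<Longrightarrow> p' \<in> c' \<Longrightarrow> q' \<in> c' \<Longrightarrow> c' = c"
      using \<psi>(3)[OF b(1) p'(1) q'(1)] p' q' by blast
    show "\<exists>!d. d \<in> ?E \<and> p \<in> d \<and> q \<in> d"
    proof (rule ex1I[of _ "\<psi> b ` c"])
      show "\<psi> b ` c \<in> ?E \<and> p \<in> \<psi> b ` c \<and> q \<in> \<psi> b ` c" using b(1) c p' q' by blast
      fix d assume d: "d \<in> ?E \<and> p \<in> d \<and> q \<in> d"
      then obtain b' c' where bc: "b' \<in> B" "c' \<in> T" "d = \<psi> b' ` c'" by blast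
      have "fst p \<in> b'" "fst q \<in> b'" using blk(1)[OF bc(1,2)] bc(3) d by auto
      then have "b' = b" by (rule b_uniq[OF bc(1)])
      then have "p' \<in> c'" "q' \<in> c'"
        using d bc(3) p' q' inj_on_image_mem_iff[OF inj _ gdd3D(5)[OF TD bc(2)]] by simp_all
      then have "c' = c" by (rule c_uniq[OF bc(2)])
      then show "d = \<psi> b ` c" using bc(3) \<open>b' = b\<close> by simp
    qed
  qed
qed

text \<open>The cells \<open>b \<times> M\<close> with \<open>b\<close> in a class \<open>P\<close>
  missing \<open>X\<close> partition \<open>(V - X) \<times> M\<close>, and the copy of a TD class
  \<open>\<rho>\<close> partitions each cell. So \<open>cls P \<rho>\<close> misses exactly the
  inflated group of \<open>X\<close>.\<close>

lemma kirkman_frame_inflate: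
  assumes frame: "kirkman_frame g u V G B" and TD: "gdd3 m 3 U K T" "resolvable U T"
    and M: "finite M" "card M = m" "m > 0"
    and \<psi>: "\<And>b. b \<in> B \<Longrightarrow> bij_betw (\<psi> b) U (b \<times> M)"
      "\<And>b c. b \<in> B \<Longrightarrow> c \<in> T \<Longrightarrow> fst ` \<psi> b ` c = b"
      "\<And>b p q. b \<in> B \<Longrightarrow> p \<in> U \<Longrightarrow> q \<in> U \<Longrightarrow> fst (\<psi> b p) \<noteq> fst (\<psi> b q)
        \<Longrightarrow> \<exists>!c. c \<in> T \<and> p \<in> c \<and> q \<in> c"
  shows "kirkman_frame (g * m) u (V \<times> M) ((\<lambda>X. X \<times> M) ` G) (\<Union>b\<in>B. (`) (\<psi> b) ` T)"
proof -
  obtain R where gdd: "gdd3 g u V G B"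
    and R: "partition_on B R" "\<And>P. P \<in> R \<Longrightarrow> \<exists>X\<in>G. partition_on (V - X) P"
    using frame by (auto simp: kirkman_frame_def)
  obtain Q where Q: "partition_on T Q" "\<And>\<rho>. \<rho> \<in> Q \<Longrightarrow> partition_on U \<rho>"
    using TD(2) by (auto simp: resolvable_def)
  have M0: "M \<noteq> {}" using M by auto
  have RB: "P \<subseteq> B" "P \<noteq> {}" if "P \<in> R" for P
    using partition_onD1[OF R(1)] partition_onD3[OF R(1)] that by blast+
  have QT: "\<rho> \<subseteq> T" "\<rho> \<noteq> {}" if "\<rho> \<in> Q" for \<rho>
    using partition_onD1[OF Q(1)] partition_onD3[OF Q(1)] that by blast+
  define cls where "cls P \<rho> = (\<Union>b\<in>P. (`) (\<psi> b) ` \<rho>)" for P \<rho>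
  let ?R = "\<Union>P\<in>R. cls P ` Q"
  have "partition_on (\<Union>b\<in>B. (`) (\<psi> b) ` T) ?R"
  proof (rule partition_onI)
    show "\<Union>?R = (\<Union>b\<in>B. (`) (\<psi> b) ` T)"
      unfolding partition_onD1[OF R(1)] partition_onD1[OF Q(1)] cls_def by blast
    show "{} \<notin> ?R" using RB(2) QT(2) unfolding cls_def by fastforce
    fix p q assume "p \<in> ?R" "q \<in> ?R" "p \<noteq> q"
    then obtain P P' \<rho> \<rho>' where P: "P \<in> R" "P' \<in> R" "\<rho> \<in> Q" "\<rho>' \<in> Q"
      and pq: "p = cls P \<rho>" "q = cls P' \<rho>'" by blast
    show "disjnt p q"
    proof (rule ccontr)
      assume "\<not> disjnt p q"
      then obtain d where "d \<in> p" "d \<in> q" unfolding disjnt_def by blast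
      then obtain b c b' c' where bc: "b \<in> P" "c \<in> \<rho>" "d = \<psi> b ` c"
        and bc': "b' \<in> P'" "c' \<in> \<rho>'" "d = \<psi> b' ` c'" unfolding pq cls_def by blast
      have B: "b \<in> B" "b' \<in> B" and T: "c \<in> T" "c' \<in> T"
        using bc bc' P RB(1) QT(1) by blast+
      \<comment> \<open>\<open>d\<close> projects onto the block beneath it, so it determines
        \<open>b\<close>; injectivity of \<open>\<psi> b\<close> then gives
        \<open>c\<close>.\<close>
      have "b = b'" using \<psi>(2)[OF B(1) T(1)] \<psi>(2)[OF B(2) T(2)] bc(3) bc'(3) by simp
      then have "P = P'" using partition_on_same[OF R(1)] P bc bc' by blast
      have "inj_on (\<psi> b) U" using \<psi>(1)[OF B(1)] by (simp add: bij_betw_def)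
      then have "c = c'"
        using inj_on_image_eq_iff[of "\<psi> b" U c c'] gdd3D(5)[OF TD(1)] T bc(3) bc'(3) \<open>b = b'\<close> by simp
      then have "\<rho> = \<rho>'" using partition_on_same[OF Q(1)] P bc bc' by blast
      then show False using \<open>P = P'\<close> \<open>p \<noteq> q\<close> pq by simp
    qed
  qed
  moreover have "\<exists>Z\<in>(\<lambda>X. X \<times> M) ` G. partition_on (V \<times> M - Z) p" if "p \<in> ?R" for p
  proof -
    obtain P \<rho> where P: "P \<in> R" "\<rho> \<in> Q" "p = cls P \<rho>"
      using \<open>p \<in> ?R\<close> by blast
    obtain X where X: "X \<in> G" "partition_on (V - X) P" using R(2)[OF P(1)] by blast
    \<comment> \<open>The union is indexed by the cells \<open>Z\<close> to fit
      \<open>partition_on_UN\<close>; the image of \<open>Z\<close> under \<open>fst\<close> gives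
      back \<open>b\<close>.\<close>
    have "partition_on ((V - X) \<times> M) (\<Union>Z\<in>(\<lambda>b. b \<times> M) ` P. (`) (\<psi> (fst ` Z)) ` \<rho>)"
    proof (rule partition_on_UN[OF partition_on_Times[OF X(2) M0]])
      fix Z assume "Z \<in> (\<lambda>b. b \<times> M) ` P"
      then obtain b where b: "b \<in> P" "Z = b \<times> M" by blast
      have "fst ` Z = b" using b M0 by simp
      moreover have "bij_betw (\<psi> b) U Z" using \<psi>(1) RB(1)[OF P(1)] b by blast
      ultimately show "partition_on Z ((`) (\<psi> (fst ` Z)) ` \<rho>)"
        using partition_on_image[OF Q(2)[OF P(2)]] by (metis bij_betw_def)
    qed
    moreover have "(\<Union>Z\<in>(\<lambda>b. b \<times> M) ` P. (`) (\<psi> (fst ` Z)) ` \<rho>) = p"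
      unfolding P(3) cls_def using M0 by simp
    moreover have "(V - X) \<times> M = V \<times> M - X \<times> M" by blast
    ultimately show ?thesis using X(1) by auto
  qed
  moreover have "gdd3 (g * m) u (V \<times> M) ((\<lambda>X. X \<times> M) ` G) (\<Union>b\<in>B. (`) (\<psi> b) ` T)"
    by (rule gdd3_inflate[OF gdd TD(1) M \<psi>])
  ultimately show ?thesis unfolding kirkman_frame_def by blast
qed

theorem theorem4p2:
  fixes g m n :: nat
  assumes "g > 0" and "m > 0" and "n > 0"
    and "exists_frame_with_subgdd (2 * g) g n"
    and "exists_resolvable_TD3 m"
    and "MK (2 * g * m + 3)"
  shows "MK (2 * g * m * n + 3)"
proof (cases "n = 1")
  case True
  then show ?thesis using assms(6) by simp
next
  case False
  obtain V :: "nat set" and G B W H A where frame: "kirkman_frame (2 * g) n V G B"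
    and sub: "gdd3 g n W H A" "gdd_subdesign H A G B"
    using assms(4) unfolding exists_frame_with_subgdd_def by blast
  obtain U :: "nat set" and K T where TD: "gdd3 m 3 U K T" "resolvable U T"
    using assms(5) unfolding exists_resolvable_TD3_def by blast
  define M where "M = {..<m}"
  have M: "finite M" "card M = m" "M \<noteq> {}" using \<open>m > 0\<close> by (auto simp: M_def)
  have gdd: "gdd3 (2 * g) n V G B" using frame by (simp add: kirkman_frame_def)
  have "\<forall>b\<in>B. \<exists>\<psi>. bij_betw \<psi> U (b \<times> M) \<and> (\<forall>c\<in>T. fst ` \<psi> ` c = b) \<and>
    (\<forall>p\<in>U. \<forall>q\<in>U. fst (\<psi> p) \<noteq> fst (\<psi> q) \<longrightarrow> (\<exists>!c. c \<in> T \<and> p \<in> c \<and> q \<in> c))"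
    using TD_on_block[OF TD(1) gdd3D(6)[OF gdd] M(1,2)] by (rule ballI)
  \<comment> \<open>The copies are fixed for all of \<open>B\<close> at once. The blocks in
    \<open>A\<close> use the same ones, so the inflated sub-GDD stays inside the inflated
    frame.\<close>
  from bchoice[OF this] obtain \<psi> where
    "\<forall>b\<in>B. bij_betw (\<psi> b) U (b \<times> M) \<and> (\<forall>c\<in>T. fst ` \<psi> b ` c = b) \<and>
    (\<forall>p\<in>U. \<forall>q\<in>U. fst (\<psi> b p) \<noteq> fst (\<psi> b q) \<longrightarrow> (\<exists>!c. c \<in> T \<and> p \<in> c \<and> q \<in> c))" ..
  then have \<psi>: "bij_betw (\<psi> b) U (b \<times> M)" "c \<in> T \<Longrightarrow> fst ` \<psi> b ` c = b"
    "p \<in> U \<Longrightarrow> q \<in> U \<Longrightarrow> fst (\<psi> b p) \<noteq> fst (\<psi> b q) \<Longrightarrow> \<exists>!c. c \<in> T \<and> p \<in> c \<and> q \<in> c"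
    if "b \<in> B" for b c p q
    using that by simp_all
  obtain f where f: "bij_betw f G H" "\<And>X. X \<in> G \<Longrightarrow> f X \<subseteq> X" and "A \<subseteq> B"
    using sub(2) by (auto simp: gdd_subdesign_def)
  let ?times = "\<lambda>X :: nat set. X \<times> M" and ?E = "\<lambda>B. \<Union>b\<in>B. (`) (\<psi> b) ` T"
  have "kirkman_frame (2 * g * m) n (V \<times> M) (?times ` G) (?E B)"
    by (rule kirkman_frame_inflate[OF frame TD M(1,2) \<open>m > 0\<close> \<psi>])
  then have frame': "kirkman_frame (2 * (g * m)) n (V \<times> M) (?times ` G) (?E B)"
    by (simp only: mult.assoc)
  have sub': "gdd3 (g * m) n (W \<times> M) (?times ` H) (?E A)"
    by (rule gdd3_inflate[OF sub(1) TD(1) M(1,2) \<open>m > 0\<close> \<psi>[OF subsetD[OF \<open>A \<subseteq> B\<close>]]])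
  have sub_frame: "gdd_subdesign (?times ` H) (?E A) (?times ` G) (?E B)"
    unfolding gdd_subdesign_def
  \<comment> \<open>A group \<open>X \<times> M\<close> is projected to \<open>X\<close>, sent to
    its subgroup by \<open>f\<close>, and inflated again.\<close>
  proof (intro conjI exI[of _ "?times \<circ> (f \<circ> (`) fst)"] ballI)
    have "bij_betw ((`) fst) (?times ` G) G"
      by (rule bij_betw_byWitness[of _ ?times]) (simp_all add: M(3) image_subset_iff)
    moreover have "bij_betw ?times H (?times ` H)"
      using Times_right_cancel[OF M(3)] by (auto simp: bij_betw_def inj_on_def)
    ultimately show "bij_betw (?times \<circ> (f \<circ> (`) fst)) (?times ` G) (?times ` H)"
      using f(1) by (blast intro: bij_betw_trans)
    show "(?times \<circ> (f \<circ> (`) fst)) Z \<subseteq> Z" if Z: "Z \<in> ?times ` G" for Z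
    proof -
      obtain X where X: "X \<in> G" "Z = X \<times> M" using Z by blast
      have "fst ` Z = X" unfolding X(2) using M(3) by simp
      moreover have "f X \<times> M \<subseteq> X \<times> M" using f(2)[OF X(1)] by (intro Sigma_mono) simp_all
      ultimately show ?thesis using X(2) by simp
    qed
    show "?E A \<subseteq> ?E B" using \<open>A \<subseteq> B\<close> by blast
  qed
  have "MK (2 * (g * m) * n + 3)"
  proof (rule MK_fill[OF frame' sub' sub_frame])
    show "MK (2 * (g * m) + 3)" using assms(6) by (simp only: mult.assoc)
    show "infinite (UNIV :: (nat \<times> nat) set)" by (simp add: finite_prod)
    show "g * m > 0" "n \<ge> 2" using assms(1-3) False by simp_all
  qed
  then show ?thesis by (simp only: mult.assoc)
qed

end
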